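(* Let $r\in\mathbb{Q}\cap\,]0,+\infty[$. There exists a finite poset $P$ such that $$r=\frac{|\mathrm{Aut}(P)|}{|P|},$$ where $\mathrm{Aut}(P)$ is the group of automorphisms of $P$ in the category of posets and order-preserving maps.
   Context: A poset is a set with a reflexive, antisymmetric, transitive relation $\leq$. A poset homomorphism is an order-preserving map ($x\leq y\Rightarrow\varphi(x)\leq\varphi(y)$); an automorphism is an invertible homomorphism from $P$ to itself whose inverse is also order-preserving. For a finite set $X$, $|X|$ denotes its number of elements. *)

theory Defs
  imports Complex_Main "HOL-Algebra.Coset" "HOL-Algebra.Bij"
begin

text \<open>
  A poset is a carrier \<open>P\<close> with a relation \<open>R\<close> such that \<open>partial_order_on P R\<close>; in
  particular \<open>R \<subseteq> P \<times> P\<close>. Maps between posets are taken extensional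
  (\<open>undefined\<close> outside the carrier), as in \<^const>\<open>Bij\<close>, so that equal maps on the carrier
  are equal functions and cardinalities of sets of maps are the intended ones.
\<close>

definition poset_hom :: "'a set \<Rightarrow> 'a rel \<Rightarrow> 'b set \<Rightarrow> 'b rel \<Rightarrow> ('a \<Rightarrow> 'b) set" where
  "poset_hom P R Q S =
     {f \<in> P \<rightarrow>\<^sub>E Q. \<forall>x\<in>P. \<forall>y\<in>P. (x, y) \<in> R \<longrightarrow> (f x, f y) \<in> S}"

definition poset_auto :: "'a set \<Rightarrow> 'a rel \<Rightarrow> ('a \<Rightarrow> 'a) set" where
  "poset_auto P R =
     {f \<in> Bij P. f \<in> poset_hom P R P R \<and> restrict (inv_into P f) P \<in> poset_hom P R P R}"

definition PosetAutoGroup :: "'a set \<Rightarrow> 'a rel \<Rightarrow> ('a \<Rightarrow> 'a) monoid" where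
  "PosetAutoGroup P R = BijGroup P \<lparr>carrier := poset_auto P R\<rparr>"

lemma poset_hom_compose:
  assumes "f \<in> poset_hom P R Q S" "g \<in> poset_hom Q S U T"
  shows "compose P g f \<in> poset_hom P R U T"
  using assms unfolding poset_hom_def by (auto simp: compose_def PiE_def Pi_def)

lemma poset_auto_iff:
  "f \<in> poset_auto P R \<longleftrightarrow>
     f \<in> Bij P \<and> (\<forall>x\<in>P. \<forall>y\<in>P. (x, y) \<in> R \<longleftrightarrow> (f x, f y) \<in> R)" (is "?L \<longleftrightarrow> ?R")
proof
  assume L: ?L
  then have f: "f \<in> Bij P" "f \<in> poset_hom P R P R"
    and g: "restrict (inv_into P f) P \<in> poset_hom P R P R"
    by (auto simp: poset_auto_def)
  have inj: "inj_on f P" and im: "f ` P = P"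
    using f(1) by (auto simp: Bij_def bij_betw_def)
  have "(x, y) \<in> R \<longleftrightarrow> (f x, f y) \<in> R" if xy: "x \<in> P" "y \<in> P" for x y
  proof
    assume "(f x, f y) \<in> R"
    moreover have "f x \<in> P" "f y \<in> P" using xy im by auto
    ultimately have "(inv_into P f (f x), inv_into P f (f y)) \<in> R"
      using g by (auto simp: poset_hom_def)
    then show "(x, y) \<in> R" using xy inj by simp
  qed (use f(2) xy in \<open>auto simp: poset_hom_def\<close>)
  with f(1) show ?R by blast
next
  assume R: ?R
  then have inj: "inj_on f P" and im: "f ` P = P" and ext: "f \<in> extensional P"
    by (auto simp: Bij_def bij_betw_def)
  have mem: "inv_into P f x \<in> P" "f (inv_into P f x) = x" if "x \<in> P" for x
    using that im by (metis inv_into_into, metis f_inv_into_f)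
  have "f \<in> poset_hom P R P R"
    using R im ext by (auto simp: poset_hom_def PiE_def)
  moreover have "restrict (inv_into P f) P \<in> poset_hom P R P R"
    using R mem by (auto simp: poset_hom_def)
  ultimately show ?L using R by (auto simp: poset_auto_def)
qed

lemma group_PosetAutoGroup: "group (PosetAutoGroup P R)"
proof -
  interpret B: group "BijGroup P" by (rule group_BijGroup)
  have "subgroup (poset_auto P R) (BijGroup P)"
  proof (rule B.subgroupI)
    show "poset_auto P R \<subseteq> carrier (BijGroup P)"
      by (auto simp: poset_auto_def BijGroup_def)
    have "(\<lambda>x\<in>P. x) \<in> poset_auto P R"
      by (auto simp: poset_auto_iff id_Bij)
    then show "poset_auto P R \<noteq> {}" by blast
  next
    fix f assume f: "f \<in> poset_auto P R"
    then have fB: "f \<in> Bij P" by (simp add: poset_auto_def)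
    then have im: "f ` P = P" by (simp add: Bij_def bij_betw_def)
    have mem: "inv_into P f x \<in> P" "f (inv_into P f x) = x" if "x \<in> P" for x
      using that im by (metis inv_into_into, metis f_inv_into_f)
    show "inv\<^bsub>BijGroup P\<^esub> f \<in> poset_auto P R"
      using f fB mem by (auto simp: inv_BijGroup poset_auto_iff restrict_inv_into_Bij)
  next
    fix f g assume f: "f \<in> poset_auto P R" and g: "g \<in> poset_auto P R"
    then have B: "f \<in> Bij P" "g \<in> Bij P" by (auto simp: poset_auto_def)
    then have gP: "g x \<in> P" if "x \<in> P" for x using that Bij_imp_funcset by blast
    have "compose P f g \<in> Bij P" using B by (rule compose_Bij)
    moreover have "(x, y) \<in> R \<longleftrightarrow> (compose P f g x, compose P f g y) \<in> R"
      if "x \<in> P" "y \<in> P" for x y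
    proof -
      have "(x, y) \<in> R \<longleftrightarrow> (g x, g y) \<in> R" using g that by (simp add: poset_auto_iff)
      also have "\<dots> \<longleftrightarrow> (f (g x), f (g y)) \<in> R"
        using f that gP by (simp add: poset_auto_iff)
      finally show ?thesis using that by (simp add: compose_def)
    qed
    ultimately have "compose P f g \<in> poset_auto P R" by (simp add: poset_auto_iff)
    then show "f \<otimes>\<^bsub>BijGroup P\<^esub> g \<in> poset_auto P R"
      using B by (simp add: BijGroup_def)
  qed
  then show ?thesis
    unfolding PosetAutoGroup_def by (rule subgroup.subgroup_is_group) (rule group_BijGroup)
qed

end

theory Submission
  imports Defs "HOL-Combinatorics.Permutations"
begin

text \<open>
  Placing a finite chain on top of a finite poset enlarges the poset without changing its group of
  automorphisms, because an automorphism must fix every element of the chain. Hence it is enough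
  to find, for \<open>r = a / b\<close>, a finite poset whose number \<open>G\<close> of automorphisms is divisible by \<open>a\<close> and
  which has at most \<open>b G / a\<close> elements; a chain then fills it up to exactly \<open>b G / a\<close> elements.
  An antichain on \<open>m\<close> elements has \<open>G = m!\<close>, and \<open>m = a + 1\<close> satisfies both requirements:
  \<open>a\<close> divides \<open>(a + 1)!\<close>, and \<open>b (a + 1)! / a = b (a + 1) (a - 1)! \<ge> a + 1\<close>.
\<close>

text \<open>
  The antichain is \<open>{..<m}\<close> and the chain is \<open>{m..<n}\<close> in its usual order. With this labelling the
  down-set of an element \<open>y\<close> of the chain is simply \<open>{..y}\<close>.
\<close>

definition chain_over_antichain :: "nat \<Rightarrow> nat \<Rightarrow> nat rel" where
  "chain_over_antichain m n = {(x, y). x < n \<and> y < n \<and> (x = y \<or> x < y \<and> m \<le> y)}"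

lemma partial_order_on_chain_over_antichain:
  "partial_order_on {..<n} (chain_over_antichain m n)"
  unfolding partial_order_on_def preorder_on_def chain_over_antichain_def
  by (auto simp: refl_on_def trans_def antisym_def)

lemma card_down_set_auto:
  assumes R: "R \<subseteq> P \<times> P" and f: "f \<in> poset_auto P R" and y: "y \<in> P"
  shows "card {x. (x, f y) \<in> R} = card {x. (x, y) \<in> R}"
proof -
  have inj: "inj_on f P" and im: "f ` P = P"
    and iff: "\<And>x y. x \<in> P \<Longrightarrow> y \<in> P \<Longrightarrow> (x, y) \<in> R \<longleftrightarrow> (f x, f y) \<in> R"
    using f by (auto simp: poset_auto_iff Bij_def bij_betw_def)
  have "{x. (x, f y) \<in> R} = f ` {x. (x, y) \<in> R}"
  proof
    show "{x. (x, f y) \<in> R} \<subseteq> f ` {x. (x, y) \<in> R}"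
    proof
      fix z assume "z \<in> {x. (x, f y) \<in> R}"
      then have z: "(z, f y) \<in> R" by simp
      then obtain x where "x \<in> P" "z = f x" using R im by blast
      then show "z \<in> f ` {x. (x, y) \<in> R}" using z iff y by blast
    qed
    show "f ` {x. (x, y) \<in> R} \<subseteq> {x. (x, f y) \<in> R}"
      using R iff by blast
  qed
  moreover have "inj_on f {x. (x, y) \<in> R}"
    using inj by (rule inj_on_subset) (use R in blast)
  ultimately show ?thesis by (simp add: card_image)
qed

text \<open>
  An element \<open>y\<close> of the chain has all of \<open>0, \<dots>, y\<close> below it, while an element of the antichain has
  only itself; so the size of the down-set tells the elements of the chain apart from each other
  and from the antichain, and automorphisms preserve this size.
\<close>

lemma auto_fixes_chain:
  assumes f: "f \<in> poset_auto {..<n} (chain_over_antichain m n)" and y: "m \<le> y" "y < n"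
  shows "f y = y"
proof -
  have chain: "card {x. (x, z) \<in> chain_over_antichain m n} = Suc z" if "m \<le> z" "z < n" for z
  proof -
    have "{x. (x, z) \<in> chain_over_antichain m n} = {..z}"
      using that by (auto simp: chain_over_antichain_def)
    then show ?thesis by simp
  qed
  have antichain: "card {x. (x, z) \<in> chain_over_antichain m n} = 1" if "z < m" "z < n" for z
  proof -
    have "{x. (x, z) \<in> chain_over_antichain m n} = {z}"
      using that by (auto simp: chain_over_antichain_def)
    then show ?thesis by simp
  qed
  have "f y < n"
    using f y by (auto simp: poset_auto_iff Bij_def bij_betw_def)
  moreover have "card {x. (x, f y) \<in> chain_over_antichain m n} = Suc y"
    using card_down_set_auto[OF _ f, of y] chain y by (auto simp: chain_over_antichain_def)
  ultimately show ?thesis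
    using chain[of "f y"] antichain[of "f y"] y by (cases "f y < m") auto
qed

text \<open>
  As the chain is fixed pointwise, an automorphism is the same as a permutation of the antichain,
  and every such permutation respects the order because all of the antichain lies below all of the
  chain.
\<close>

lemma poset_auto_chain_over_antichain:
  assumes "m \<le> n"
  shows "poset_auto {..<n} (chain_over_antichain m n) =
           (\<lambda>p. restrict p {..<n}) ` {p. p permutes {..<m}}"
proof (intro equalityI subsetI)
  fix f assume f: "f \<in> poset_auto {..<n} (chain_over_antichain m n)"
  have inj: "inj_on f {..<n}" and im: "f ` {..<n} = {..<n}" and ext: "f \<in> extensional {..<n}"
    using f by (auto simp: poset_auto_iff Bij_def bij_betw_def)
  have fix_chain: "f y = y" if "m \<le> y" "y < n" for y
    using auto_fixes_chain[OF f that] .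
  have "f x < m" if "x < m" for x
  proof (rule ccontr)
    assume "\<not> f x < m"
    moreover have "f x < n" using im that assms by auto
    ultimately have "f (f x) = f x" using fix_chain by simp
    then have "f x = x" using inj that assms \<open>f x < n\<close> by (auto simp: inj_on_def)
    then show False using that \<open>\<not> f x < m\<close> by simp
  qed
  then have "f ` {..<m} \<subseteq> {..<m}" by auto
  moreover have "inj_on f {..<m}" using inj by (rule inj_on_subset) (use assms in auto)
  ultimately have "bij_betw f {..<m} {..<m}"
    by (simp add: bij_betw_def endo_inj_surj)
  define p where "p = (\<lambda>x. if x < m then f x else x)"
  have "bij_betw p {..<m} {..<m}"
    using \<open>bij_betw f {..<m} {..<m}\<close> by (rule bij_betw_cong[THEN iffD1, rotated]) (simp add: p_def)
  then have "p permutes {..<m}"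
    by (rule bij_imp_permutes) (simp add: p_def)
  moreover have "f = restrict p {..<n}"
    using ext fix_chain by (auto simp: p_def restrict_def extensional_def fun_eq_iff)
  ultimately show "f \<in> (\<lambda>p. restrict p {..<n}) ` {p. p permutes {..<m}}" by blast
next
  fix f assume "f \<in> (\<lambda>p. restrict p {..<n}) ` {p. p permutes {..<m}}"
  then obtain p where p: "p permutes {..<m}" and f: "f = restrict p {..<n}" by blast
  have pn: "p permutes {..<n}" using permutes_subset[OF p] assms by auto
  have "bij_betw f {..<n} {..<n}"
    using permutes_imp_bij[OF pn] by (rule bij_betw_cong[THEN iffD1, rotated]) (simp add: f)
  then have "f \<in> Bij {..<n}" by (simp add: f Bij_def)
  moreover have "(x, y) \<in> chain_over_antichain m n \<longleftrightarrow> (p x, p y) \<in> chain_over_antichain m n"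
    if "x < n" "y < n" for x y
  proof -
    have lt: "p z < n \<longleftrightarrow> z < n" "p z < m \<longleftrightarrow> z < m" for z
      using permutes_in_image[OF pn, of z] permutes_in_image[OF p, of z] by auto
    have fix_chain: "p z = z" if "m \<le> z" for z
      using permutes_not_in[OF p] that by simp
    have "p x = p y \<longleftrightarrow> x = y" using permutes_inj[OF p] by (auto simp: inj_def)
    then show ?thesis
      using lt[of x] lt[of y] fix_chain[of x] fix_chain[of y] that
      unfolding chain_over_antichain_def by (cases "x < m"; cases "y < m") auto
  qed
  ultimately show "f \<in> poset_auto {..<n} (chain_over_antichain m n)"
    by (simp add: poset_auto_iff f)
qed

lemma card_poset_auto_chain_over_antichain:
  assumes "m \<le> n"
  shows "card (poset_auto {..<n} (chain_over_antichain m n)) = fact m"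
proof -
  have "inj_on (\<lambda>p. restrict p {..<n}) {p. p permutes {..<m}}"
  proof (rule inj_onI)
    fix p q
    assume "p \<in> {p. p permutes {..<m}}" "q \<in> {p. p permutes {..<m}}"
      and eq: "restrict p {..<n} = restrict q {..<n}"
    then have "p permutes {..<n}" "q permutes {..<n}"
      using permutes_subset[of _ "{..<m}" "{..<n}"] assms by auto
    then show "p = q"
      using eq by (metis ext permutes_not_in restrict_apply')
  qed
  then show ?thesis
    by (simp add: poset_auto_chain_over_antichain[OF assms] card_image card_permutations)
qed

theorem theorem1p4:
  fixes r :: rat
  assumes "0 < r"
  shows "\<exists>(P :: nat set) (R :: nat rel).
           finite P \<and> partial_order_on P R \<and>
           r = of_nat (order (PosetAutoGroup P R)) / of_nat (card P)"
proof -
  obtain i j where ij: "quotient_of r = (i, j)" by fastforce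
  define a b where "a = nat i" and "b = nat j"
  have j: "j > 0" using quotient_of_denom_pos[OF ij] .
  moreover have req: "r = of_int i / of_int j" using quotient_of_div[OF ij] .
  ultimately have i: "i > 0" using assms by (simp add: zero_less_divide_iff)
  have a: "a > 0" and b: "b > 0" and r: "r = of_nat a / of_nat b"
    using i j req by (simp_all add: a_def b_def)
  define m where "m = Suc a"
  \<comment> \<open>This is \<open>b m! / a\<close>, written without division.\<close>
  define n where "n = b * (m * fact (a - 1))"
  have "fact a = a * fact (a - 1)" using a by (simp add: fact_reduce)
  then have an: "a * n = b * fact m" by (simp add: n_def m_def algebra_simps)
  have "1 * (m * 1) \<le> n"
    unfolding n_def using b by (intro mult_le_mono) (simp_all add: Suc_le_eq)
  then have mn: "m \<le> n" by simp
  then have "n > 0" by (simp add: m_def)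
  have "order (PosetAutoGroup {..<n} (chain_over_antichain m n)) = fact m"
    using card_poset_auto_chain_over_antichain[OF mn]
    by (simp add: order_def PosetAutoGroup_def)
  moreover have "r = of_nat (fact m) / of_nat n"
  proof -
    have "(of_nat a * of_nat n :: rat) = of_nat b * of_nat (fact m)"
      using an by (metis of_nat_mult)
    then show ?thesis using b \<open>n > 0\<close> unfolding r by (simp add: frac_eq_eq mult.commute)
  qed
  ultimately have "r = of_nat (order (PosetAutoGroup {..<n} (chain_over_antichain m n))) /
      of_nat (card {..<n})" by simp
  then show ?thesis
    using partial_order_on_chain_over_antichain by blast
qed

end
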